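(* Let $D(x)=1-28x-84x^2+27x^3$ and define integer sequences by the formal power series expansions \[ \frac{6+184x+54x^2}{D(x)}=\sum_{n\ge0}a_nx^n,\ \frac{14-64x+126x^2}{D(x)}=\sum_{n\ge0}b_nx^n,\ \frac{9-81x^2}{D(x)}=\sum_{n\ge0}c_nx^n, \] \[ \frac{4-36x^2}{D(x)}=\sum_{n\ge0}d_nx^n,\ \frac{15-135x^2}{D(x)}=\sum_{n\ge0}e_nx^n. \] Then for all $n\ge0$, $a_n^4+b_n^4+c_n^4+d_n^4=e_n^4-\big(8\cdot(-3)^n\big)^4$. *)

theory Defs
  imports "HOL-Computational_Algebra.Formal_Power_Series"
begin

text \<open>The library divides formal power series only over coefficient types with an inverse, so
  the quotients are formed over the rationals and the integer sequences are embedded there.\<close>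

definition D :: "rat fps" where
  "D = 1 - 28 * fps_X - 84 * fps_X ^ 2 + 27 * fps_X ^ 3"

definition gen_fun :: "(nat \<Rightarrow> int) \<Rightarrow> rat fps" where
  "gen_fun s = Abs_fps (\<lambda>n. of_int (s n))"

text \<open>Since \<open>D\<close> has constant term 1, every quotient of an integer polynomial by \<open>D\<close> has integer
  coefficients. For numerators of degree at most 2 this is the following existence statement.\<close>

fun rec_seq :: "int \<Rightarrow> int \<Rightarrow> int \<Rightarrow> nat \<Rightarrow> int" where
  "rec_seq p q r 0 = p"
| "rec_seq p q r (Suc 0) = q + 28 * p"
| "rec_seq p q r (Suc (Suc 0)) = r + 28 * (q + 28 * p) + 84 * p"
| "rec_seq p q r (Suc (Suc (Suc n))) =
     28 * rec_seq p q r (Suc (Suc n)) + 84 * rec_seq p q r (Suc n) - 27 * rec_seq p q r n"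

lemma gen_fun_exists:
  "\<exists>s. gen_fun s = (of_int p + of_int q * fps_X + of_int r * fps_X ^ 2) / D"
proof -
  let ?s = "rec_seq p q r"
  have nz: "fps_nth D 0 \<noteq> 0" by (simp add: D_def)
  have "gen_fun ?s * D = of_int p + of_int q * fps_X + of_int r * fps_X ^ 2"
  proof (rule fps_ext)
    fix n
    have e: "gen_fun ?s * D = gen_fun ?s - fps_const 28 * (fps_X * gen_fun ?s)
        - fps_const 84 * (fps_X ^ 2 * gen_fun ?s) + fps_const 27 * (fps_X ^ 3 * gen_fun ?s)"
      by (simp add: D_def algebra_simps numeral_fps_const)
    consider "n = 0" | "n = 1" | "n = 2" | m where "n = Suc (Suc (Suc m))"
      by (metis One_nat_def Suc_1 not0_implies_Suc)
    then show "fps_nth (gen_fun ?s * D) n =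
        fps_nth (of_int p + of_int q * fps_X + of_int r * fps_X ^ 2) n"
      unfolding e
      by cases (simp_all add: gen_fun_def fps_X_power_mult_nth fps_of_int [symmetric]
          fps_X_power_nth numeral_2_eq_2 numeral_3_eq_3 del: power_Suc)
  qed
  then have "gen_fun ?s = (of_int p + of_int q * fps_X + of_int r * fps_X ^ 2) / D"
    using nz by (metis fps_nonzero_nth nonzero_mult_div_cancel_right)
  then show ?thesis by blast
qed

end

theory Submission
  imports Defs
begin

text \<open>Since \<open>D = (1 + 3x)(1 - 31x + 9x\<^sup>2)\<close>, the quotients decompose as \<open>a = 10u - 4(-3)\<^sup>n\<close>,
  \<open>b = 10u + 4(-3)\<^sup>n\<close> and \<open>(c, d, e) = (9t, 4t, 15t)\<close>, where \<open>u\<close> and \<open>t\<close> have the generating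
  functions \<open>(1 + 3x)/(1 - 31x + 9x\<^sup>2)\<close> and \<open>(1 - 3x)/(1 - 31x + 9x\<^sup>2)\<close>. In particular
  \<open>b - a = 8(-3)\<^sup>n\<close>, so \<open>a\<^sup>4 + b\<^sup>4 + (b - a)\<^sup>4 = 2(a\<^sup>2 - ab + b\<^sup>2)\<^sup>2\<close> reduces the claim to
  \<open>a\<^sup>2 - ab + b\<^sup>2 = 148t\<^sup>2\<close>, because \<open>15\<^sup>4 - 9\<^sup>4 - 4\<^sup>4 = 2 * 148\<^sup>2\<close>. That is the Pell-type equation
  \<open>37t\<^sup>2 - 25u\<^sup>2 = 12 * 9\<^sup>n\<close>.\<close>

text \<open>Multiplying by \<open>D\<close> and comparing coefficients forces the initial values and
  the recurrence.\<close>

lemma rec_seq_unique: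
  assumes "gen_fun s = (of_int p + of_int q * fps_X + of_int r * fps_X ^ 2) / D"
  shows "s n = rec_seq p q r n"
proof -
  have nz: "fps_nth D 0 \<noteq> 0" by (simp add: D_def)
  then have "gen_fun s * D = of_int p + of_int q * fps_X + of_int r * fps_X ^ 2"
    using assms by (simp add: fps_divide_unit mult.assoc inverse_mult_eq_1)
  moreover have "gen_fun s * D = gen_fun s - fps_const 28 * (fps_X * gen_fun s)
      - fps_const 84 * (fps_X ^ 2 * gen_fun s) + fps_const 27 * (fps_X ^ 3 * gen_fun s)"
    by (simp add: D_def algebra_simps numeral_fps_const)
  ultimately have coeff: "fps_nth (gen_fun s - fps_const 28 * (fps_X * gen_fun s)
      - fps_const 84 * (fps_X ^ 2 * gen_fun s) + fps_const 27 * (fps_X ^ 3 * gen_fun s)) k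
    = fps_nth (of_int p + of_int q * fps_X + of_int r * fps_X ^ 2) k" for k
    by simp
  note nth_simps = gen_fun_def fps_X_power_mult_nth fps_of_int [symmetric] fps_X_power_nth
    numeral_2_eq_2 numeral_3_eq_3
  have "(of_int (s 0) :: rat) = of_int p"
    using coeff[of 0] by (simp add: nth_simps del: power_Suc)
  then have s0: "s 0 = p"
    by simp
  have "(of_int (s (Suc 0)) :: rat) = of_int (q + 28 * s 0)"
    using coeff[of "Suc 0"] by (simp add: nth_simps del: power_Suc)
  then have s1: "s (Suc 0) = q + 28 * s 0"
    by (simp only: of_int_eq_iff)
  have "(of_int (s (Suc (Suc 0))) :: rat) = of_int (r + 28 * s (Suc 0) + 84 * s 0)"
    using coeff[of "Suc (Suc 0)"] by (simp add: nth_simps del: power_Suc)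
  then have s2: "s (Suc (Suc 0)) = r + 28 * s (Suc 0) + 84 * s 0"
    by (simp only: of_int_eq_iff)
  have s3: "s (Suc (Suc (Suc m))) = 28 * s (Suc (Suc m)) + 84 * s (Suc m) - 27 * s m" for m
  proof -
    have "(of_int (s (Suc (Suc (Suc m)))) :: rat)
        = of_int (28 * s (Suc (Suc m)) + 84 * s (Suc m) - 27 * s m)"
      using coeff[of "Suc (Suc (Suc m))"] by (simp add: nth_simps del: power_Suc)
    then show ?thesis
      by (simp only: of_int_eq_iff)
  qed
  show ?thesis
    by (induction n rule: rec_seq.induct[where P = "\<lambda>_ _ _ n. P n" for P]) (use s0 s1 s2 s3 in simp_all)
qed

fun quad_seq :: "int \<Rightarrow> int \<Rightarrow> nat \<Rightarrow> int" where
  "quad_seq p q 0 = p"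
| "quad_seq p q (Suc 0) = q"
| "quad_seq p q (Suc (Suc n)) = 31 * quad_seq p q (Suc n) - 9 * quad_seq p q n"

text \<open>Partial fractions: the arguments of \<open>rec_seq\<close> are the coefficients of
  \<open>k(p + (q - 31p)x)(1 + 3x) + m(1 - 31x + 9x^2)\<close>.\<close>

lemma rec_seq_quad_seq:
  "rec_seq (k * p + m) (k * (q - 28 * p) - 31 * m) (k * (3 * q - 93 * p) + 9 * m) n
    = k * quad_seq p (q :: int) n + m * (- 3) ^ n"
  by (induction n rule: rec_seq.induct[where P = "\<lambda>_ _ _ n. P n" for P])
    (simp_all add: algebra_simps)

text \<open>The step matrix has determinant 9 and scales the form \<open>37t\<^sup>2 - 25u\<^sup>2\<close> by that factor.\<close>

lemma quad_seq_step:
  defines "u \<equiv> quad_seq 1 34" and "t \<equiv> quad_seq 1 28"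
  shows "2 * u (Suc n) = 31 * u n + 37 * t n \<and> 2 * t (Suc n) = 25 * u n + 31 * t n"
  by (induction n) (auto simp: u_def t_def)

lemma quad_seq_Pell:
  "37 * quad_seq 1 28 n ^ 2 = 25 * quad_seq 1 34 n ^ 2 + 12 * 9 ^ n"
proof (induction n)
  case (Suc n)
  define u t u' t' where "u = quad_seq 1 34 n" and "t = quad_seq 1 28 n"
    and "u' = quad_seq 1 34 (Suc n)" and "t' = quad_seq 1 28 (Suc n)"
  have step: "2 * u' = 31 * u + 37 * t" "2 * t' = 25 * u + 31 * t"
    using quad_seq_step[of n] by (simp_all add: u_def t_def u'_def t'_def)
  \<comment> \<open>The factor 4 clears the halves in the step matrix; then 36 = 4 * 9.\<close>
  have "4 * (37 * t' ^ 2 - 25 * u' ^ 2) = 37 * (2 * t') ^ 2 - 25 * (2 * u') ^ 2"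
    by (simp add: power2_eq_square)
  also have "\<dots> = 36 * (37 * t ^ 2 - 25 * u ^ 2)"
    unfolding step by (simp add: power2_eq_square algebra_simps)
  also have "\<dots> = 4 * (12 * 9 ^ Suc n)"
    using Suc.IH by (simp add: u_def t_def)
  finally show ?case
    by (simp add: u'_def t'_def)
qed simp

theorem theorem2p7:
  fixes a b c d e :: "nat \<Rightarrow> int"
  assumes "gen_fun a = (6 + 184 * fps_X + 54 * fps_X ^ 2) / D"
    and "gen_fun b = (14 - 64 * fps_X + 126 * fps_X ^ 2) / D"
    and "gen_fun c = (9 - 81 * fps_X ^ 2) / D"
    and "gen_fun d = (4 - 36 * fps_X ^ 2) / D"
    and "gen_fun e = (15 - 135 * fps_X ^ 2) / D"
  shows "\<forall>n. a n ^ 4 + b n ^ 4 + c n ^ 4 + d n ^ 4 = e n ^ 4 - (8 * (- 3) ^ n) ^ 4"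
proof
  fix n
  define u t w :: int where "u = quad_seq 1 34 n" and "t = quad_seq 1 28 n" and "w = (- 3) ^ n"
  have an: "a n = 10 * u - 4 * w"
    using rec_seq_unique[of a 6 184 54 n] rec_seq_quad_seq[of 10 1 "- 4" 34 n] assms(1)
    by (simp add: u_def w_def)
  have bn: "b n = 10 * u + 4 * w"
    using rec_seq_unique[of b 14 "- 64" 126 n] rec_seq_quad_seq[of 10 1 4 34 n] assms(2)
    by (simp add: u_def w_def)
  \<comment> \<open>From here on \<open>m = 0\<close>: the numerators are multiples of
    \<open>1 - 9x^2 = (1 - 3x)(1 + 3x)\<close>.\<close>
  have cn: "c n = 9 * t"
    using rec_seq_unique[of c 9 0 "- 81" n] rec_seq_quad_seq[of 9 1 0 28 n] assms(3)
    by (simp add: t_def)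
  have dn: "d n = 4 * t"
    using rec_seq_unique[of d 4 0 "- 36" n] rec_seq_quad_seq[of 4 1 0 28 n] assms(4)
    by (simp add: t_def)
  have en: "e n = 15 * t"
    using rec_seq_unique[of e 15 0 "- 135" n] rec_seq_quad_seq[of 15 1 0 28 n] assms(5)
    by (simp add: t_def)
  have "w ^ 2 = 9 ^ n"
    by (simp add: w_def power2_eq_square flip: power_mult_distrib)
  then have pell: "100 * u ^ 2 + 48 * w ^ 2 = 148 * t ^ 2"
    using quad_seq_Pell[of n] by (simp add: u_def t_def)
  \<comment> \<open>Here \<open>8w = b - a\<close> and
    \<open>a^2 - ab + b^2 = 100u^2 + 48w^2\<close>.\<close>
  have "a n ^ 4 + b n ^ 4 + (8 * w) ^ 4 = 2 * (100 * u ^ 2 + 48 * w ^ 2) ^ 2"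
    unfolding an bn by algebra
  also have "\<dots> = e n ^ 4 - c n ^ 4 - d n ^ 4"
    unfolding pell cn dn en by algebra
  finally show "a n ^ 4 + b n ^ 4 + c n ^ 4 + d n ^ 4 = e n ^ 4 - (8 * (- 3) ^ n) ^ 4"
    by (simp add: w_def)
qed

end
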